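(* Let $G\subsetneq\mathbb{D}$ be any horo-convex domain. Then, for each $z\in G$, $$\nu_G(z)\geq\frac{\pi}{e^{2d_G(z)}}\,\frac{1}{\sin\!\left(\dfrac{\pi}{e^{2d_G(z)}}\right)},$$ with equality at a point if and only if $G$ is a horo-crescent domain.
   Context: $\mathbb{D}=\{z\in\mathbb{C}:|z|<1\}$ and $\mathbb{T}=\partial\mathbb{D}$. A domain is a nonempty open connected set. A horodisk is an open Euclidean disk $H\subset\mathbb{D}$ whose boundary circle is internally tangent to $\mathbb{T}$ at exactly one point. A domain $G\subset\mathbb{D}$ is horo-convex (horocyclically convex) if for every $\omega\in\mathbb{D}\cap\partial G$ there exists a horodisk $H$ such that $\omega\in\partial H$ and $G\cap H=\emptyset$. A horo-crescent is a domain of the form $\mathbb{D}\setminus\overline{H}$ with $H$ a horodisk. The hyperbolic metric of $\mathbb{D}$ is $\lambda_{\mathbb{D}}(z)|dz|=|dz|/(1-|z|^2)$ (Gaussian curvature $-4$), with distance $d_{\mathbb{D}}(z,w)=\operatorname{arctanh}\left|\frac{z-w}{1-\bar z w}\right|$. For a proper subdomain $G$ of $\mathbb{D}$, $\lambda_G(z)|dz|$ is its hyperbolic metric with the same normalization, i.e. $\lambda_G(f(\zeta))|f'(\zeta)|=1/(1-|\zeta|^2)$ for a holomorphic universal covering $f:\mathbb{D}\to G$ (a conformal map if $G$ is simply connected). The hyperbolic density is $\nu_G(z)=(1-|z|^2)\lambda_G(z)$, and $d_G(z)=\inf\{d_{\mathbb{D}}(z,w):w\in\partial G\cap\mathbb{D}\}$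 is the hyperbolic distance from $z\in G$ to the boundary of $G$. *)

theory Defs
  imports "HOL-Complex_Analysis.Complex_Analysis"
begin

abbreviation unit_disk :: "complex set" where
  "unit_disk \<equiv> ball 0 1"

definition is_domain :: "complex set \<Rightarrow> bool" where
  "is_domain G \<longleftrightarrow> G \<noteq> {} \<and> open G \<and> connected G"

text \<open>The condition that the two circles share exactly one point excludes the unit disk itself.\<close>

definition horodisk :: "complex set \<Rightarrow> bool" where
  "horodisk H \<longleftrightarrow>
     (\<exists>c r. 0 < r \<and> H = ball c r \<and> H \<subseteq> unit_disk \<and> (\<exists>p. sphere c r \<inter> sphere 0 1 = {p}))"

definition horo_convex_domain :: "complex set \<Rightarrow> bool" where
  "horo_convex_domain G \<longleftrightarrow> is_domain G \<and> G \<subseteq> unit_disk \<and>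
     (\<forall>\<omega> \<in> unit_disk \<inter> frontier G. \<exists>H. horodisk H \<and> \<omega> \<in> frontier H \<and> G \<inter> H = {})"

definition horo_crescent :: "complex set \<Rightarrow> bool" where
  "horo_crescent G \<longleftrightarrow> is_domain G \<and> (\<exists>H. horodisk H \<and> G = unit_disk - closure H)"

text \<open>Since the unit disk is simply connected, any covering by it is universal.\<close>

definition holomorphic_universal_covering :: "(complex \<Rightarrow> complex) \<Rightarrow> complex set \<Rightarrow> bool" where
  "holomorphic_universal_covering f G \<longleftrightarrow>
     f holomorphic_on unit_disk \<and> covering_space unit_disk f G"

text \<open>
  The density $\lambda_G$ of the hyperbolic metric, normalized to curvature $-4$. The value does
  not depend on the covering \<open>f\<close> or on the preimage \<open>\<zeta>\<close> of \<open>z\<close>, because two such coverings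
  differ by an automorphism of the disk; it is unspecified if \<open>G\<close> has no covering by the disk.
\<close>

definition hyperbolic_metric :: "complex set \<Rightarrow> complex \<Rightarrow> real" where
  "hyperbolic_metric G z =
     (THE l. \<exists>f \<zeta>. holomorphic_universal_covering f G \<and> \<zeta> \<in> unit_disk \<and> f \<zeta> = z \<and>
        l * cmod (deriv f \<zeta>) = 1 / (1 - (cmod \<zeta>)\<^sup>2))"

definition hyperbolic_density :: "complex set \<Rightarrow> complex \<Rightarrow> real" where
  "hyperbolic_density G z = (1 - (cmod z)\<^sup>2) * hyperbolic_metric G z"

definition hyperbolic_dist :: "complex \<Rightarrow> complex \<Rightarrow> real" where
  "hyperbolic_dist z w = artanh (cmod ((z - w) / (1 - cnj z * w)))"

text \<open>
  The infimum is meaningful only if \<open>G\<close> has boundary points inside the unit disk, as is the case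
  for every nonempty open proper subset of the disk.
\<close>

definition hyperbolic_boundary_dist :: "complex set \<Rightarrow> complex \<Rightarrow> real" where
  "hyperbolic_boundary_dist G z = (INF w \<in> frontier G \<inter> unit_disk. hyperbolic_dist z w)"

end

theory Submission
  imports Defs
begin

text \<open>
  A tangency point \<open>p\<close> of a horodisk is sent to infinity by a conformal map of the disk onto the
  upper half-plane that turns the horodisk into the half-plane \<open>Im > 1\<close> and its crescent into the
  strip \<open>0 < Im < 1\<close>. The strip is uniformized by the exponential function, so at height \<open>y\<close> the
  density of the crescent is \<open>\<pi>y / sin (\<pi>y)\<close>, while the distance to the line \<open>Im = 1\<close> is
  \<open>- ln y / 2\<close>. A horo-convex domain \<open>G\<close> lies in the crescent of the horodisk that touches it at
  the boundary point nearest to \<open>z\<close>; by the Schwarz-Pick lemma its density at \<open>z\<close> is at least that of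
  the crescent, with equality only if \<open>G\<close> is the crescent. Every component of the complement of \<open>G\<close>
  reaches the unit circle through a closed horodisk, so \<open>G\<close> is simply connected and has a
  Riemann map.
\<close>

section \<open>Moebius maps of the disk and the Schwarz-Pick lemma\<close>

lemma Moebius_deriv:
  assumes "1 - cnj w * z \<noteq> 0"
  shows "(Moebius_function 0 w has_field_derivative (1 - (cmod w)\<^sup>2) / (1 - cnj w * z)\<^sup>2) (at z)"
proof -
  have e: "w * cnj w = (complex_of_real (cmod w))\<^sup>2"
    by (simp add: complex_norm_square[symmetric])
  have "(Moebius_function 0 w has_field_derivative
      (1 * (1 - cnj w * z) - (z - w) * (- cnj w)) / ((1 - cnj w * z) * (1 - cnj w * z))) (at z)"
    unfolding Moebius_function_simple[abs_def]
    using assms by (intro DERIV_divide) (auto intro!: derivative_eq_intros)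
  moreover have "1 * (1 - cnj w * z) - (z - w) * (- cnj w) = 1 - (complex_of_real (cmod w))\<^sup>2"
    by (simp add: e[symmetric] algebra_simps)
  ultimately show ?thesis by (metis of_real_1 of_real_diff of_real_power power2_eq_square)
qed

lemma cmod_lt_1_imp_one_minus_ne_0:
  fixes w z :: complex
  assumes "cmod w < 1" "cmod z \<le> 1"
  shows "1 - cnj w * z \<noteq> 0"
proof
  assume "1 - cnj w * z = 0"
  hence "cnj w * z = 1" by simp
  hence "cmod w * cmod z = 1" by (metis complex_mod_cnj norm_mult norm_one)
  moreover have "cmod w * cmod z \<le> cmod w * 1" by (intro mult_left_mono assms norm_ge_zero)
  ultimately show False using assms by linarith
qed

text \<open>Composing with Moebius maps that carry 0 to \<open>\<zeta>\<close> and
  \<open>h \<zeta>\<close> to 0 reduces both parts to the Schwarz lemma at the origin. In the case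
  of equality the composed map is a rotation; of this only the surjectivity of \<open>h\<close> is
  recorded, which is what the rigidity argument for domains uses.\<close>

lemma Schwarz_Pick:
  assumes holh: "h holomorphic_on unit_disk" and him: "h ` unit_disk \<subseteq> unit_disk"
    and \<zeta>: "\<zeta> \<in> unit_disk"
  shows "cmod (deriv h \<zeta>) * (1 - (cmod \<zeta>)\<^sup>2) \<le> 1 - (cmod (h \<zeta>))\<^sup>2"
    and "cmod (deriv h \<zeta>) * (1 - (cmod \<zeta>)\<^sup>2) = 1 - (cmod (h \<zeta>))\<^sup>2 \<Longrightarrow> unit_disk \<subseteq> h ` unit_disk"
proof -
  define M where "M = Moebius_function 0 (h \<zeta>)"
  define N where "N = Moebius_function 0 (- \<zeta>)"
  define g where "g = M \<circ> h \<circ> N"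
  have \<zeta>1: "cmod \<zeta> < 1" using \<zeta> by simp
  have h\<zeta>: "cmod (h \<zeta>) < 1" using him \<zeta> by force
  have h1: "cmod (h z) < 1" if "cmod z < 1" for z using him that by force
  have holM: "M holomorphic_on unit_disk" and holN: "N holomorphic_on unit_disk"
    unfolding M_def N_def using Moebius_function_holomorphic \<zeta>1 h\<zeta> by auto
  have M1: "cmod (M z) < 1" if "cmod z < 1" for z
    unfolding M_def using Moebius_function_norm_lt_1 h\<zeta> that by blast
  have N1: "cmod (N z) < 1" if "cmod z < 1" for z
    unfolding N_def using Moebius_function_norm_lt_1[of "-\<zeta>" z 0] \<zeta>1 that by simp
  have N0: "N 0 = \<zeta>" by (simp add: N_def Moebius_function_def)
  have holg: "g holomorphic_on ball 0 1"
    unfolding g_def comp_assoc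
    using holomorphic_on_compose_gen[OF holomorphic_on_compose_gen[OF holN holh] holM] N1 h1
    by (fastforce simp: comp_assoc)
  have g0: "g 0 = 0" by (simp add: g_def N0 M_def Moebius_function_eq_zero)
  have g1: "cmod (g z) < 1" if "cmod z < 1" for z
    using M1 h1 N1 that by (simp add: g_def)
  have nz: "1 - (cmod (h \<zeta>))\<^sup>2 > 0" "1 - (cmod \<zeta>)\<^sup>2 > 0"
    using \<zeta>1 h\<zeta> by (simp_all add: power_less_one_iff abs_square_less_1)
  have dN: "(N has_field_derivative complex_of_real (1 - (cmod \<zeta>)\<^sup>2)) (at 0)"
    using Moebius_deriv[of "-\<zeta>" 0] by (simp add: N_def)
  have ne: "1 - cnj (h \<zeta>) * h \<zeta> \<noteq> 0"
    using cmod_lt_1_imp_one_minus_ne_0 h\<zeta> by simp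
  have e: "1 - cnj (h \<zeta>) * h \<zeta> = complex_of_real (1 - (cmod (h \<zeta>))\<^sup>2)"
    using complex_norm_square[of "h \<zeta>"] by (simp add: mult.commute)
  have dM: "(M has_field_derivative complex_of_real (1 / (1 - (cmod (h \<zeta>))\<^sup>2))) (at (h \<zeta>))"
  proof -
    have "a / a\<^sup>2 = 1 / a" for a :: complex by (simp add: power2_eq_square)
    thus ?thesis
      using Moebius_deriv[OF ne] unfolding e M_def by (metis of_real_1 of_real_divide)
  qed
  have dh: "(h has_field_derivative deriv h \<zeta>) (at \<zeta>)"
    using holh \<zeta> holomorphic_derivI open_ball by blast
  have "(g has_field_derivative (1 / (1 - (cmod (h \<zeta>))\<^sup>2)) * (deriv h \<zeta> * (1 - (cmod \<zeta>)\<^sup>2))) (at 0)"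
    unfolding g_def comp_assoc
    by (rule DERIV_chain[where g="h \<circ> N"], (use dM N0 in simp), rule DERIV_chain)
       (use dM dh dN N0 in simp_all)
  hence dg: "deriv g 0 = (1 / (1 - (cmod (h \<zeta>))\<^sup>2)) * (deriv h \<zeta> * (1 - (cmod \<zeta>)\<^sup>2))"
    by (rule DERIV_imp_deriv)
  have ng: "cmod (deriv g 0) = cmod (deriv h \<zeta>) * (1 - (cmod \<zeta>)\<^sup>2) / (1 - (cmod (h \<zeta>))\<^sup>2)"
  proof -
    have "deriv g 0 = deriv h \<zeta> * of_real ((1 - (cmod \<zeta>)\<^sup>2) / (1 - (cmod (h \<zeta>))\<^sup>2))"
      by (simp add: dg)
    thus ?thesis using nz by (simp add: norm_mult del: of_real_divide of_real_diff)
  qed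
  have z0: "norm (0::complex) < 1" by simp
  show "cmod (deriv h \<zeta>) * (1 - (cmod \<zeta>)\<^sup>2) \<le> 1 - (cmod (h \<zeta>))\<^sup>2"
    using Schwarz_Lemma(2)[OF holg g0 g1 z0] nz by (simp add: ng divide_simps)
  assume eq: "cmod (deriv h \<zeta>) * (1 - (cmod \<zeta>)\<^sup>2) = 1 - (cmod (h \<zeta>))\<^sup>2"
  have "cmod (deriv g 0) = 1" using nz by (simp add: ng eq)
  then obtain \<alpha> where \<alpha>: "\<And>z. cmod z < 1 \<Longrightarrow> g z = \<alpha> * z" "cmod \<alpha> = 1"
    using Schwarz_Lemma(3)[OF holg g0 g1 z0] by blast
  show "unit_disk \<subseteq> h ` unit_disk"
  proof
    fix w :: complex assume w: "w \<in> unit_disk"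
    \<comment> \<open>The rotation \<open>g\<close> sends this \<open>v\<close> to
      \<open>M w\<close>; undoing \<open>M\<close> shows that \<open>N v\<close> is a preimage of
      \<open>w\<close> under \<open>h\<close>.\<close>
    define v where "v = M w / \<alpha>"
    have v: "cmod v < 1" using M1 w \<alpha> by (simp add: v_def norm_divide)
    have "M (h (N v)) = M w" using \<alpha>(1)[OF v] \<alpha>(2) by (auto simp: g_def v_def)
    moreover have "Moebius_function 0 (- h \<zeta>) (M u) = u" if "cmod u < 1" for u
      unfolding M_def using Moebius_function_compose[of "- h \<zeta>" "h \<zeta>" u] h\<zeta> that by simp
    ultimately have "h (N v) = w" using h1 N1 v w by (metis mem_ball_0)
    thus "w \<in> h ` unit_disk" using N1[OF v] by force
  qed
qed

text \<open>The inverse of \<open>h\<close> is again a holomorphic self-map of the disk, so the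
  Schwarz-Pick inequality holds in both directions.\<close>

lemma Schwarz_Pick_bij:
  assumes holh: "h holomorphic_on unit_disk" and bij: "bij_betw h unit_disk unit_disk"
    and \<zeta>: "\<zeta> \<in> unit_disk"
  shows "cmod (deriv h \<zeta>) * (1 - (cmod \<zeta>)\<^sup>2) = 1 - (cmod (h \<zeta>))\<^sup>2"
proof -
  have im: "h ` unit_disk = unit_disk" using bij by (simp add: bij_betw_def)
  obtain g where g: "g holomorphic_on (h ` unit_disk)"
     "\<And>z. z \<in> unit_disk \<Longrightarrow> deriv h z * deriv g (h z) = 1"
     "\<And>z. z \<in> unit_disk \<Longrightarrow> g (h z) = z"
    using holomorphic_has_inverse[OF holh open_ball bij_betw_imp_inj_on[OF bij]] by metis
  have him: "h \<zeta> \<in> unit_disk" using im \<zeta> by blast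
  have gim: "g ` unit_disk \<subseteq> unit_disk"
    using im g(3) by (smt (verit) image_iff image_subsetI)
  have 1: "cmod (deriv h \<zeta>) * (1 - (cmod \<zeta>)\<^sup>2) \<le> 1 - (cmod (h \<zeta>))\<^sup>2"
    using Schwarz_Pick(1)[OF holh _ \<zeta>] im by simp
  have 2: "cmod (deriv g (h \<zeta>)) * (1 - (cmod (h \<zeta>))\<^sup>2) \<le> 1 - (cmod \<zeta>)\<^sup>2"
    using Schwarz_Pick(1)[OF _ gim him] g(1,3) im \<zeta> by simp
  have 3: "cmod (deriv h \<zeta>) * cmod (deriv g (h \<zeta>)) = 1"
    by (metis g(2)[OF \<zeta>] norm_mult norm_one)
  have "1 - (cmod (h \<zeta>))\<^sup>2 = cmod (deriv h \<zeta>) * (cmod (deriv g (h \<zeta>)) * (1 - (cmod (h \<zeta>))\<^sup>2))"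
    using 3 by (simp add: mult.assoc[symmetric])
  also have "\<dots> \<le> cmod (deriv h \<zeta>) * (1 - (cmod \<zeta>)\<^sup>2)"
    by (intro mult_left_mono 2 norm_ge_zero)
  finally show ?thesis using 1 by linarith
qed

section \<open>The hyperbolic metric of a simply connected domain\<close>

text \<open>The identity of \<open>S\<close> lifts to a section \<open>s\<close> of \<open>f\<close>
  through \<open>a\<close>. Both \<open>s \<circ> f\<close> and the identity of \<open>C\<close> are
  lifts of \<open>f\<close> that agree at \<open>a\<close>, so they coincide on the connected set
  \<open>C\<close>, and \<open>s\<close> is a left inverse of \<open>f\<close>.\<close>

lemma covering_space_simply_connected_imp_inj_on:
  fixes f :: "'a::real_normed_vector \<Rightarrow> 'b::real_normed_vector"
  assumes cov: "covering_space C f S" and C: "connected C" and S: "simply_connected S" "locally path_connected S"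
  shows "inj_on f C"
proof
  fix a b assume ab: "a \<in> C" "b \<in> C" "f a = f b"
  have fC: "f \<in> C \<rightarrow> S" using covering_space_imp_surjective[OF cov] by blast
  obtain s where s: "continuous_on S s" "s \<in> S \<rightarrow> C" "s (f a) = a" "\<And>y. y \<in> S \<Longrightarrow> f (s y) = y"
    using covering_space_lift_strong[OF cov ab(1) _ S, of "f a" "\<lambda>x. x"] fC ab(1) by auto
  have "s (f x) = x" if "x \<in> C" for x
  proof (rule covering_space_lift_unique[OF cov, where T=C and f=f and a=a and x=x])
    show "continuous_on C f" using cov covering_space_imp_continuous by blast
    then show "continuous_on C (\<lambda>x. s (f x))"
      by (rule continuous_on_compose2[OF s(1)]) (use fC in blast)
  qed (use s fC C ab that in \<open>auto simp: Pi_iff\<close>)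
  thus "a = b" using ab by metis
qed

text \<open>This makes the definite description in \<open>hyperbolic_metric\<close> computable. The
  inverse of \<open>\<Psi>\<close> is one covering. Any other covering \<open>f\<close> is injective
  because \<open>G\<close> is simply connected, so \<open>\<Psi> \<circ> f\<close> is an
  automorphism of the disk, and equality in Schwarz-Pick yields the same value.\<close>

lemma hyperbolic_metric_eq:
  assumes "open G" and hol: "\<Psi> holomorphic_on G" and bij: "bij_betw \<Psi> G unit_disk" and z: "z \<in> G"
  shows "hyperbolic_metric G z = cmod (deriv \<Psi> z) / (1 - (cmod (\<Psi> z))\<^sup>2)"
proof -
  have inj: "inj_on \<Psi> G" and im: "\<Psi> ` G = unit_disk" using bij by (auto simp: bij_betw_def)
  obtain g where g: "g holomorphic_on unit_disk" "\<And>z. z \<in> G \<Longrightarrow> g (\<Psi> z) = z"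
    using holomorphic_has_inverse[OF hol \<open>open G\<close> inj] im by metis
  have gG: "g w \<in> G \<and> \<Psi> (g w) = w" if "w \<in> unit_disk" for w
    using that im g(2) by (metis image_iff)
  have "homeomorphism unit_disk G g \<Psi>"
    unfolding homeomorphism_def using g gG im hol holomorphic_on_imp_continuous_on by (force simp: image_iff)
  hence cov: "holomorphic_universal_covering g G"
    unfolding holomorphic_universal_covering_def using g(1) homeomorphism_imp_covering_space by blast
  have sc: "simply_connected G"
    using Riemann_mapping_theorem[of G] hol g gG im by blast
  have key: "cmod (deriv f \<zeta>) \<noteq> 0 \<and> 
      (l * cmod (deriv f \<zeta>) = 1 / (1 - (cmod \<zeta>)\<^sup>2) \<longleftrightarrow> l = cmod (deriv \<Psi> z) / (1 - (cmod (\<Psi> z))\<^sup>2))"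
    if f: "holomorphic_universal_covering f G" "\<zeta> \<in> unit_disk" "f \<zeta> = z" for f \<zeta> l
  proof -
    have holf: "f holomorphic_on unit_disk" and covf: "covering_space unit_disk f G"
      using f by (auto simp: holomorphic_universal_covering_def)
    have fim: "f ` unit_disk = G" using covering_space_imp_surjective[OF covf] .
    have "inj_on f unit_disk"
      by (rule covering_space_simply_connected_imp_inj_on[OF covf _ sc])
         (auto simp: open_imp_locally_path_connected \<open>open G\<close>)
    hence "bij_betw f unit_disk G" using fim by (simp add: bij_betw_def)
    hence b: "bij_betw (\<Psi> \<circ> f) unit_disk unit_disk" using bij bij_betw_trans by blast
    have h: "(\<Psi> \<circ> f) holomorphic_on unit_disk"
      using holomorphic_on_compose_gen[OF holf hol] fim by simp
    have "((\<Psi> \<circ> f) has_field_derivative (deriv \<Psi> z * deriv f \<zeta>)) (at \<zeta>)"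
      by (rule DERIV_chain)
         (use holomorphic_derivI[OF hol \<open>open G\<close> z] holomorphic_derivI[OF holf open_ball f(2)] f(3) in auto)
    hence "deriv (\<Psi> \<circ> f) \<zeta> = deriv \<Psi> z * deriv f \<zeta>" by (rule DERIV_imp_deriv)
    with Schwarz_Pick_bij[OF h b f(2)]
    have eq: "cmod (deriv \<Psi> z) * cmod (deriv f \<zeta>) * (1 - (cmod \<zeta>)\<^sup>2) = 1 - (cmod (\<Psi> z))\<^sup>2"
      by (simp add: norm_mult f(3))
    have "cmod (\<Psi> z) < 1" using im z by force
    hence pos: "1 - (cmod (\<Psi> z))\<^sup>2 > 0" "1 - (cmod \<zeta>)\<^sup>2 > 0"
      using f(2) by (simp_all add: abs_square_less_1)
    have nz: "cmod (deriv \<Psi> z) \<noteq> 0" "cmod (deriv f \<zeta>) \<noteq> 0" using eq pos by auto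
    then show ?thesis
      unfolding eq[symmetric] using pos by (simp add: eq_divide_eq mult_ac)
  qed
  show ?thesis
    unfolding hyperbolic_metric_def
  proof (rule the_equality)
    show "\<exists>f \<zeta>. holomorphic_universal_covering f G \<and> \<zeta> \<in> unit_disk \<and> f \<zeta> = z \<and>
       cmod (deriv \<Psi> z) / (1 - (cmod (\<Psi> z))\<^sup>2) * cmod (deriv f \<zeta>) = 1 / (1 - (cmod \<zeta>)\<^sup>2)"
    proof (intro exI conjI)
      show w: "\<Psi> z \<in> unit_disk" using im z by blast
      show "cmod (deriv \<Psi> z) / (1 - (cmod (\<Psi> z))\<^sup>2) * cmod (deriv g (\<Psi> z)) =
          1 / (1 - (cmod (\<Psi> z))\<^sup>2)"
        using key[OF cov w g(2)[OF z]] by blast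
    qed (use cov g(2)[OF z] in auto)
  next
    fix l
    assume "\<exists>f \<zeta>. holomorphic_universal_covering f G \<and> \<zeta> \<in> unit_disk \<and> f \<zeta> = z \<and>
       l * cmod (deriv f \<zeta>) = 1 / (1 - (cmod \<zeta>)\<^sup>2)"
    then show "l = cmod (deriv \<Psi> z) / (1 - (cmod (\<Psi> z))\<^sup>2)"
      using key by metis
  qed
qed

text \<open>In the uniformizing coordinates the inclusion of \<open>G\<close> in \<open>G'\<close>
  becomes the self-map \<open>\<Phi> \<circ> g\<close> of the disk, where \<open>g\<close> inverts
  \<open>\<Psi>\<close>, and Schwarz-Pick applies to it. Equality makes this map surjective; since
  \<open>g\<close> has its values in \<open>G\<close> and \<open>\<Phi>\<close> is injective on
  \<open>G'\<close>, no point of \<open>G'\<close> lies outside \<open>G\<close>.\<close>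

lemma hyperbolic_metric_mono:
  assumes G: "open G" "\<Psi> holomorphic_on G" "bij_betw \<Psi> G unit_disk" and z: "z \<in> G"
    and G': "open G'" "\<Phi> holomorphic_on G'" "bij_betw \<Phi> G' unit_disk" and sub: "G \<subseteq> G'"
  shows "hyperbolic_metric G' z \<le> hyperbolic_metric G z"
    and "hyperbolic_metric G' z = hyperbolic_metric G z \<Longrightarrow> G = G'"
proof -
  have inj: "inj_on \<Psi> G" and im: "\<Psi> ` G = unit_disk" using G by (auto simp: bij_betw_def)
  have inj': "inj_on \<Phi> G'" and im': "\<Phi> ` G' = unit_disk" using G' by (auto simp: bij_betw_def)
  obtain g where g: "g holomorphic_on unit_disk" "\<And>z. z \<in> G \<Longrightarrow> deriv \<Psi> z * deriv g (\<Psi> z) = 1"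
      "\<And>z. z \<in> G \<Longrightarrow> g (\<Psi> z) = z"
    using holomorphic_has_inverse[OF G(2,1) inj] im by metis
  have gG: "g w \<in> G" if "w \<in> unit_disk" for w
    using that im g(3) by (metis image_iff)
  have w: "\<Psi> z \<in> unit_disk" using im z by blast
  have h: "(\<Phi> \<circ> g) holomorphic_on unit_disk"
    using holomorphic_on_compose_gen[OF g(1) G'(2)] gG sub by blast
  have him: "(\<Phi> \<circ> g) ` unit_disk \<subseteq> unit_disk"
    using gG sub im' by fastforce
  have zG': "z \<in> G'" using z sub by blast
  have "((\<Phi> \<circ> g) has_field_derivative (deriv \<Phi> z * deriv g (\<Psi> z))) (at (\<Psi> z))"
    by (rule DERIV_chain)
       (use holomorphic_derivI[OF G'(2,1) zG'] holomorphic_derivI[OF g(1) open_ball w] g(3)[OF z] in auto)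
  hence dh: "deriv (\<Phi> \<circ> g) (\<Psi> z) = deriv \<Phi> z * deriv g (\<Psi> z)" by (rule DERIV_imp_deriv)
  have nz: "cmod (deriv \<Psi> z) * cmod (deriv g (\<Psi> z)) = 1"
    by (metis g(2)[OF z] norm_mult norm_one)
  have "cmod (\<Psi> z) < 1" "cmod (\<Phi> z) < 1" using w im' zG' by force+
  hence pos: "1 - (cmod (\<Psi> z))\<^sup>2 > 0" "1 - (cmod (\<Phi> z))\<^sup>2 > 0"
    by (simp_all add: abs_square_less_1)
  have dp: "cmod (deriv \<Psi> z) > 0" using nz by (metis mult_zero_left norm_eq_zero zero_less_norm_iff zero_neq_one)
  have dg: "cmod (deriv g (\<Psi> z)) = 1 / cmod (deriv \<Psi> z)" using nz dp by (simp add: field_simps)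
  have m: "hyperbolic_metric G z = cmod (deriv \<Psi> z) / (1 - (cmod (\<Psi> z))\<^sup>2)"
    "hyperbolic_metric G' z = cmod (deriv \<Phi> z) / (1 - (cmod (\<Phi> z))\<^sup>2)"
    using hyperbolic_metric_eq[OF G z] hyperbolic_metric_eq[OF G' zG'] by auto
  have c: "cmod (deriv (\<Phi> \<circ> g) (\<Psi> z)) = cmod (deriv \<Phi> z) / cmod (deriv \<Psi> z)"
    by (simp add: dh norm_mult dg)
  have c2: "(\<Phi> \<circ> g) (\<Psi> z) = \<Phi> z" by (simp add: g(3)[OF z])
  show "hyperbolic_metric G' z \<le> hyperbolic_metric G z"
    using Schwarz_Pick(1)[OF h him w] pos dp unfolding m c c2 by (simp add: field_simps)
  assume "hyperbolic_metric G' z = hyperbolic_metric G z"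
  hence "unit_disk \<subseteq> (\<Phi> \<circ> g) ` unit_disk"
    by (intro Schwarz_Pick(2)[OF h him w]) (use pos dp in \<open>simp add: m c c2[unfolded o_def] field_simps\<close>)
  hence "\<exists>u\<in>G. \<Phi> u = \<Phi> v" if "v \<in> G'" for v
    using that im' gG by (smt (verit) comp_apply image_iff subset_iff)
  hence "G' \<subseteq> G" using inj' sub by (metis inj_onD subset_iff)
  thus "G = G'" using sub by blast
qed

section \<open>The half-plane chart at a boundary point of the disk\<close>

text \<open>For \<open>cmod p = 1\<close> and \<open>k > 0\<close> this is the Cayley transform of
  the disk onto the upper half-plane that takes \<open>p\<close> to infinity and 0 to
  \<open>\<i> * k\<close>. The scale \<open>k\<close> is left free so that any chosen horocycle at
  \<open>p\<close> can be put at height 1.\<close>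

definition horo_chart :: "real \<Rightarrow> complex \<Rightarrow> complex \<Rightarrow> complex" where
  "horo_chart k p z = \<i> * of_real k * (p + z) / (p - z)"

text \<open>Besides inverting the chart, the instance \<open>horo_chart_inv 1 1\<close> serves as
  the standard map of the upper half-plane onto the disk.\<close>

definition horo_chart_inv :: "real \<Rightarrow> complex \<Rightarrow> complex \<Rightarrow> complex" where
  "horo_chart_inv k p w = p * (w - \<i> * of_real k) / (w + \<i> * of_real k)"

text \<open>The height is \<open>k\<close> times the Poisson kernel, the real part of
  \<open>(p + z) / (p - z)\<close>. Its level sets are the horocycles at \<open>p\<close>.\<close>

lemma Im_horo_chart:
  assumes "cmod p = 1"
  shows "Im (horo_chart k p z) = k * (1 - (cmod z)\<^sup>2) / (cmod (p - z))\<^sup>2"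
proof -
  have "horo_chart k p z = \<i> * (of_real k * ((p + z) / (p - z)))"
    by (simp add: horo_chart_def)
  moreover have "Im (\<i> * (of_real k * w)) = k * Re w" for w by simp
  ultimately have "Im (horo_chart k p z) = k * Re ((p + z) / (p - z))" by metis
  also have "(p + z) / (p - z) = ((p + z) * cnj (p - z)) / (cmod (p - z))\<^sup>2"
    by (rule complex_div_cnj)
  also have "Re \<dots> = Re ((p + z) * cnj (p - z)) / (cmod (p - z))\<^sup>2"
    using Re_divide_of_real[of _ "(cmod (p - z))\<^sup>2"] by simp
  also have "Re ((p + z) * cnj (p - z)) = (cmod p)\<^sup>2 - (cmod z)\<^sup>2"
    by (simp only: cmod_power2) (simp add: algebra_simps power2_eq_square)
  finally show ?thesis by (simp add: assms)
qed

text \<open>All three facts come from |w + ik|^2 - |w - ik|^2 = 4k Im w. The second one also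
  supplies the denominator \<open>1 - (cmod (\<Psi> z))\<^sup>2\<close> in the density of the
  crescent.\<close>

lemma horo_chart_inv_norm:
  assumes "cmod p = 1" "k > 0" "Im w > 0"
  shows "w + \<i> * of_real k \<noteq> 0"
    and "1 - (cmod (horo_chart_inv k p w))\<^sup>2 = 4 * k * Im w / (cmod (w + \<i> * of_real k))\<^sup>2"
    and "cmod (horo_chart_inv k p w) < 1"
proof -
  show nz: "w + \<i> * of_real k \<noteq> 0"
    using assms by (auto simp: complex_eq_iff)
  have "(cmod (w + \<i> * of_real k))\<^sup>2 - (cmod (w - \<i> * of_real k))\<^sup>2 = 4 * k * Im w"
    by (simp only: cmod_power2) (simp add: algebra_simps power2_eq_square)
  thus *: "1 - (cmod (horo_chart_inv k p w))\<^sup>2 = 4 * k * Im w / (cmod (w + \<i> * of_real k))\<^sup>2"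
    using nz assms by (simp add: horo_chart_inv_def norm_mult norm_divide power_divide divide_simps)
  have "4 * k * Im w / (cmod (w + \<i> * of_real k))\<^sup>2 > 0" using nz assms by simp
  thus "cmod (horo_chart_inv k p w) < 1" using * abs_square_less_1[of "cmod (horo_chart_inv k p w)"] by simp
qed

lemma horo_chart_bij:
  assumes p: "cmod p = 1" and k: "k > 0"
  shows "\<And>z. z \<in> unit_disk \<Longrightarrow> Im (horo_chart k p z) > 0"
    and "\<And>z. z \<in> unit_disk \<Longrightarrow> horo_chart_inv k p (horo_chart k p z) = z"
    and "\<And>w. Im w > 0 \<Longrightarrow> horo_chart k p (horo_chart_inv k p w) = w"
proof -
  have p0: "p \<noteq> 0" using p by auto
  fix z assume z: "z \<in> unit_disk"
  have pz: "p - z \<noteq> 0" using p z by auto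
  have "1 - (cmod z)\<^sup>2 > 0" using z by (simp add: abs_square_less_1)
  thus "Im (horo_chart k p z) > 0" using k pz by (simp add: Im_horo_chart[OF p])
  have "horo_chart k p z - \<i> * of_real k = \<i> * of_real k * (2 * z) / (p - z)"
       "horo_chart k p z + \<i> * of_real k = \<i> * of_real k * (2 * p) / (p - z)"
    unfolding horo_chart_def using pz by (simp_all add: field_simps)
  thus "horo_chart_inv k p (horo_chart k p z) = z"
    unfolding horo_chart_inv_def using pz p0 k by simp
next
  have p0: "p \<noteq> 0" using p by auto
  fix w assume w: "Im w > 0"
  have nz: "w + \<i> * of_real k \<noteq> 0" using horo_chart_inv_norm(1)[OF p k w] .
  have "p + horo_chart_inv k p w = p * (2 * w) / (w + \<i> * of_real k)"
       "p - horo_chart_inv k p w = p * (2 * \<i> * of_real k) / (w + \<i> * of_real k)"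
    unfolding horo_chart_inv_def using nz by (simp_all add: field_simps)
  thus "horo_chart k p (horo_chart_inv k p w) = w"
    unfolding horo_chart_def using nz p0 k by simp
qed

lemma horo_chart_deriv:
  assumes "p \<noteq> z"
  shows "(horo_chart k p has_field_derivative 2 * \<i> * of_real k * p / (p - z)\<^sup>2) (at z)"
proof -
  have "(horo_chart k p has_field_derivative
      (\<i> * of_real k * (p - z) - \<i> * of_real k * (p + z) * (- 1)) / ((p - z) * (p - z))) (at z)"
    unfolding horo_chart_def[abs_def]
    using assms by (intro DERIV_divide) (auto intro!: derivative_eq_intros)
  moreover have "\<i> * of_real k * (p - z) - \<i> * of_real k * (p + z) * (- 1) = 2 * \<i> * of_real k * p"
    by (simp add: algebra_simps)
  ultimately show ?thesis by (simp add: power2_eq_square)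
qed

lemma horo_chart_inv_deriv:
  assumes "w + \<i> * of_real k \<noteq> 0"
  shows "(horo_chart_inv k p has_field_derivative 2 * \<i> * of_real k * p / (w + \<i> * of_real k)\<^sup>2) (at w)"
proof -
  have "(horo_chart_inv k p has_field_derivative
      (p * (w + \<i> * of_real k) - p * (w - \<i> * of_real k) * 1) / 
       ((w + \<i> * of_real k) * (w + \<i> * of_real k))) (at w)"
    unfolding horo_chart_inv_def[abs_def]
    using assms by (intro DERIV_divide) (auto intro!: derivative_eq_intros)
  moreover have "p * (w + \<i> * of_real k) - p * (w - \<i> * of_real k) * 1 = 2 * \<i> * of_real k * p"
    by (simp add: algebra_simps)
  ultimately show ?thesis by (simp add: power2_eq_square)
qed

section \<open>Uniformization and density of a horo-crescent\<close>

text \<open>For \<open>cmod p = 1\<close> and \<open>k > 0\<close> this is the preimage of the strip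
  0 < Im < 1, as the chart has positive imaginary part on the disk.\<close>

definition horo_crescent_at :: "real \<Rightarrow> complex \<Rightarrow> complex set" where
  "horo_crescent_at k p = {z \<in> unit_disk. Im (horo_chart k p z) < 1}"

lemma open_horo_crescent_at:
  assumes "cmod p = 1"
  shows "open (horo_crescent_at k p)"
proof -
  have "continuous_on unit_disk (horo_chart k p)"
    unfolding horo_chart_def[abs_def] using assms by (auto intro!: continuous_intros)
  hence "open (horo_chart k p -` {w. Im w < 1} \<inter> unit_disk)"
    using continuous_on_open_vimage[OF open_ball] open_halfspace_Im_lt by blast
  moreover have "horo_chart k p -` {w. Im w < 1} \<inter> unit_disk = horo_crescent_at k p"
    by (auto simp: horo_crescent_at_def)
  ultimately show ?thesis by simp
qed

text \<open>The chart leads to the strip, exp(pi w) opens the strip to the upper half-plane, and the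
  Cayley transform leads back to the disk. The last claim is the resulting density, already
  multiplied by \<open>1 - (cmod z)\<^sup>2\<close>.\<close>

lemma horo_crescent_at_uniformization:
  assumes p: "cmod p = 1" and k: "k > 0"
  obtains \<Psi> where "\<Psi> holomorphic_on horo_crescent_at k p" "bij_betw \<Psi> (horo_crescent_at k p) unit_disk"
    "\<And>z. z \<in> horo_crescent_at k p \<Longrightarrow>
      (1 - (cmod z)\<^sup>2) * (cmod (deriv \<Psi> z) / (1 - (cmod (\<Psi> z))\<^sup>2)) =
        pi * Im (horo_chart k p z) / sin (pi * Im (horo_chart k p z))"
proof
  define E where "E = (\<lambda>z. exp (of_real pi * horo_chart k p z))"
  define \<Psi> where "\<Psi> = (\<lambda>z. horo_chart_inv 1 1 (E z))"
  note c = horo_chart_bij[OF p k] and c1 = horo_chart_bij[OF norm_one zero_less_one]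
  note n1 = horo_chart_inv_norm[OF norm_one zero_less_one]
  have ImE: "Im (E z) = cmod (E z) * sin (pi * Im (horo_chart k p z))" for z
    by (simp add: E_def Im_exp)
  have sp: "sin (pi * Im (horo_chart k p z)) > 0" and E0: "Im (E z) > 0" and pz: "p \<noteq> z" and zD: "z \<in> unit_disk"
    if "z \<in> horo_crescent_at k p" for z
  proof -
    show z: "z \<in> unit_disk" using that by (simp add: horo_crescent_at_def)
    have "Im (horo_chart k p z) > 0" "Im (horo_chart k p z) < 1"
      using that c(1)[OF z] by (auto simp: horo_crescent_at_def)
    thus s: "sin (pi * Im (horo_chart k p z)) > 0" by (intro sin_gt_zero) auto
    have "cmod (E z) > 0" by (simp add: E_def)
    thus "Im (E z) > 0" using s unfolding ImE by simp
    show "p \<noteq> z" using p z by auto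
  qed
  have d: "(\<Psi> has_field_derivative 2 * \<i> / (E z + \<i>)\<^sup>2 * 
       (E z * (of_real pi * (2 * \<i> * of_real k * p / (p - z)\<^sup>2)))) (at z)"
    if z: "z \<in> horo_crescent_at k p" for z
  proof -
    have "((\<lambda>z. of_real pi * horo_chart k p z) has_field_derivative 
       of_real pi * (2 * \<i> * of_real k * p / (p - z)\<^sup>2)) (at z)"
      by (rule DERIV_cmult[OF horo_chart_deriv[OF pz[OF z]]])
    hence 1: "(E has_field_derivative E z * (of_real pi * (2 * \<i> * of_real k * p / (p - z)\<^sup>2))) (at z)"
      unfolding E_def by (rule DERIV_chain2[OF DERIV_exp])
    show ?thesis
      unfolding \<Psi>_def
      using DERIV_chain2[OF horo_chart_inv_deriv[of "E z" 1 1] 1] n1(1)[OF E0[OF z]] by simp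
  qed
  show "\<Psi> holomorphic_on horo_crescent_at k p"
    using d open_horo_crescent_at[OF p] holomorphic_on_open by blast
  have "\<exists>z \<in> horo_crescent_at k p. \<Psi> z = u" if u: "u \<in> unit_disk" for u
  proof -
    define w where "w = horo_chart 1 1 u"
    have w: "Im w > 0" using c1(1)[OF u] by (simp add: w_def)
    have w0: "w \<noteq> 0" using w by auto
    \<comment> \<open>The argument of a point of the upper half-plane lies strictly between 0 and
      pi, so this logarithm lands in the strip.\<close>
    define v where "v = Ln w / of_real pi"
    have "0 < Im (Ln w)" "Im (Ln w) < pi" using Im_Ln_pos_lt_imp[OF w] by auto
    hence v: "0 < Im v" "Im v < 1" by (simp_all add: v_def Im_divide_of_real)
    define z where "z = horo_chart_inv k p v"
    have "z \<in> horo_crescent_at k p"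
      using v horo_chart_inv_norm(3)[OF p k v(1)] c(3)[OF v(1)] by (simp add: horo_crescent_at_def z_def)
    moreover have "E z = w"
      unfolding E_def z_def c(3)[OF v(1)] using w0 by (simp add: v_def)
    hence "\<Psi> z = u" by (simp add: \<Psi>_def w_def c1(2)[OF u])
    ultimately show ?thesis by blast
  qed
  moreover have "\<Psi> z \<in> unit_disk" if z: "z \<in> horo_crescent_at k p" for z
    using n1(3)[OF E0[OF z]] by (simp add: \<Psi>_def)
  moreover have "inj_on \<Psi> (horo_crescent_at k p)"
  proof
    fix x y assume x: "x \<in> horo_crescent_at k p" and y: "y \<in> horo_crescent_at k p" and e: "\<Psi> x = \<Psi> y"
    have "E x = E y" using c1(3)[OF E0[OF x]] c1(3)[OF E0[OF y]] e unfolding \<Psi>_def by metis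
    \<comment> \<open>On the strip the exponent has imaginary part between 0 and pi, where the
      principal logarithm inverts the exponential; this gives injectivity.\<close>
    moreover have "Ln (E z) = of_real pi * horo_chart k p z" if z: "z \<in> horo_crescent_at k p" for z
    proof -
      have "Im (horo_chart k p z) > 0" "Im (horo_chart k p z) < 1"
        using z c(1)[OF zD[OF z]] by (auto simp: horo_crescent_at_def)
      hence "0 < pi * Im (horo_chart k p z)" "pi * Im (horo_chart k p z) < pi" by auto
      thus ?thesis unfolding E_def by (intro Ln_exp) (use pi_gt_zero in \<open>simp_all del: pi_gt_zero\<close>)
    qed
    ultimately have "horo_chart k p x = horo_chart k p y" using x y by (metis mult_cancel_left of_real_eq_0_iff pi_neq_zero)
    thus "x = y" using c(2) zD x y by metis
  qed
  ultimately show "bij_betw \<Psi> (horo_crescent_at k p) unit_disk"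
    unfolding bij_betw_def by blast
  fix z assume z: "z \<in> horo_crescent_at k p"
  define y where "y = Im (horo_chart k p z)"
  \<comment> \<open>The quantity k / |p - z|^2 is half the modulus of the derivative of the chart.
    This identity is how the Euclidean factor \<open>1 - (cmod z)\<^sup>2\<close> is absorbed into
    the height \<open>y\<close>.\<close>
  have y: "(1 - (cmod z)\<^sup>2) * (k / (cmod (p - z))\<^sup>2) = y" by (simp add: y_def Im_horo_chart[OF p])
  have 1: "1 - (cmod (\<Psi> z))\<^sup>2 = 4 * (cmod (E z) * sin (pi * y)) / (cmod (E z + \<i>))\<^sup>2"
    using n1(2)[OF E0[OF z]] by (simp add: \<Psi>_def ImE y_def)
  have 2: "cmod (deriv \<Psi> z) = 2 / (cmod (E z + \<i>))\<^sup>2 * (cmod (E z) * (pi * (2 * (k / (cmod (p - z))\<^sup>2))))"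
    using k p by (simp add: DERIV_imp_deriv[OF d[OF z]] norm_mult norm_divide norm_power)
  have "cmod (E z + \<i>) \<noteq> 0" "cmod (E z) \<noteq> 0" using n1(1)[OF E0[OF z]] by (simp_all add: E_def)
  hence "cmod (deriv \<Psi> z) / (1 - (cmod (\<Psi> z))\<^sup>2) = pi * (k / (cmod (p - z))\<^sup>2) / sin (pi * y)"
    unfolding 1 2 by simp
  thus "(1 - (cmod z)\<^sup>2) * (cmod (deriv \<Psi> z) / (1 - (cmod (\<Psi> z))\<^sup>2)) =
        pi * Im (horo_chart k p z) / sin (pi * Im (horo_chart k p z))"
    by (simp add: y[symmetric] y_def[symmetric])
qed

lemma horo_crescent_at_density:
  assumes p: "cmod p = 1" and k: "k > 0" and z: "z \<in> horo_crescent_at k p"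
  shows "hyperbolic_density (horo_crescent_at k p) z =
    pi * Im (horo_chart k p z) / sin (pi * Im (horo_chart k p z))"
  using horo_crescent_at_uniformization[OF p k] hyperbolic_metric_eq[OF open_horo_crescent_at[OF p]] z
  unfolding hyperbolic_density_def by metis

section \<open>Monotonicity of x / sin x\<close>

lemma mult_cos_le_sin:
  fixes x :: real assumes "0 \<le> x" "x \<le> pi"
  shows "x * cos x \<le> sin x"
proof -
  have "sin 0 - 0 * cos 0 \<le> sin x - x * cos x"
  proof (rule DERIV_nonneg_imp_nondecreasing[OF assms(1)])
    fix t :: real assume "0 \<le> t" "t \<le> x"
    hence "t * sin t \<ge> 0" using assms sin_ge_zero by simp
    moreover have "((\<lambda>t. sin t - t * cos t) has_real_derivative t * sin t) (at t)"
      by (auto intro!: derivative_eq_intros)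
    ultimately show "\<exists>y. ((\<lambda>t. sin t - t * cos t) has_real_derivative y) (at t) \<and> 0 \<le> y" by blast
  qed
  thus ?thesis by simp
qed

text \<open>The derivative has numerator sin t - t cos t, which is nonnegative by
  \<open>mult_cos_le_sin\<close>. This converts a comparison of distances into a comparison of
  density bounds.\<close>

lemma divide_sin_mono:
  fixes x y :: real assumes "0 < x" "x \<le> y" "y < pi"
  shows "x / sin x \<le> y / sin y"
proof (rule DERIV_nonneg_imp_nondecreasing[OF assms(2)])
  fix t assume t: "x \<le> t" "t \<le> y"
  have s: "sin t > 0" using t assms by (intro sin_gt_zero) auto
  have "((\<lambda>t. t / sin t) has_real_derivative (sin t - t * cos t) / (sin t * sin t)) (at t)"
    using s by (auto intro!: derivative_eq_intros)
  moreover have "(sin t - t * cos t) / (sin t * sin t) \<ge> 0"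
    using mult_cos_le_sin[of t] s t assms by simp
  ultimately show "\<exists>y. ((\<lambda>t. t / sin t) has_real_derivative y) (at t) \<and> 0 \<le> y" by blast
qed

section \<open>Hyperbolic distance in the half-plane chart\<close>

lemma pseudo_hyperbolic_lt_1:
  assumes "z \<in> unit_disk" "w \<in> unit_disk"
  shows "cmod ((z - w) / (1 - cnj z * w)) < 1"
  using Moebius_function_norm_lt_1[of z w 0] assms
  by (simp add: Moebius_function_simple norm_divide norm_minus_commute)

text \<open>Exponentiating removes the inverse hyperbolic tangent and gives the quantity that occurs
  in the theorem; distances are compared in this form.\<close>

lemma exp_hyperbolic_dist:
  assumes "z \<in> unit_disk" "w \<in> unit_disk"
  defines "\<rho> \<equiv> cmod ((z - w) / (1 - cnj z * w))"
  shows "exp (2 * hyperbolic_dist z w) = (1 + \<rho>) / (1 - \<rho>)"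
proof -
  have "0 \<le> \<rho>" "\<rho> < 1" using pseudo_hyperbolic_lt_1[OF assms(1,2)] by (auto simp: \<rho>_def)
  thus ?thesis by (simp add: hyperbolic_dist_def artanh_def \<rho>_def[symmetric])
qed

text \<open>The right-hand side is the pseudo-hyperbolic distance of the upper half-plane, with the
  conjugate as reflection in the real line. Both differences on the right carry the same factor 2k /
  (|p - z| |p - w|), which cancels.\<close>

lemma pseudo_hyperbolic_horo_chart:
  assumes p: "cmod p = 1" and k: "k > 0" and z: "z \<in> unit_disk" and w: "w \<in> unit_disk"
  shows "cmod ((z - w) / (1 - cnj z * w)) =
    cmod (horo_chart k p z - horo_chart k p w) / cmod (horo_chart k p z - cnj (horo_chart k p w))"
proof -
  have pz: "p - z \<noteq> 0" "p - w \<noteq> 0" using p z w by auto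
  hence cz: "cnj p - cnj w \<noteq> 0" by (metis complex_cnj_cancel_iff eq_iff_diff_eq_0)
  have pp: "p * cnj p = 1" using p complex_norm_square[of p] by simp
  have "horo_chart k p z - horo_chart k p w = 2 * \<i> * of_real k * p * (z - w) / ((p - z) * (p - w))"
    unfolding horo_chart_def using pz by (simp add: field_simps)
  hence 1: "cmod (horo_chart k p z - horo_chart k p w) = 2 * k * cmod (z - w) / (cmod (p - z) * cmod (p - w))"
    using p k by (simp add: norm_mult norm_divide)
  have "horo_chart k p z - cnj (horo_chart k p w) =
      \<i> * of_real k * ((p + z) * (cnj p - cnj w) + (cnj p + cnj w) * (p - z)) / ((p - z) * (cnj p - cnj w))"
    unfolding horo_chart_def using pz cz by (simp add: field_simps)
  also have "(p + z) * (cnj p - cnj w) + (cnj p + cnj w) * (p - z) = 2 * (p * cnj p) - 2 * (z * cnj w)"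
    by (simp add: algebra_simps)
  \<comment> \<open>Here \<open>cmod p = 1\<close> enters, as \<open>p * cnj p = 1\<close>.\<close>
  also have "\<dots> = 2 * cnj (1 - cnj z * w)" by (simp add: pp)
  finally have "horo_chart k p z - cnj (horo_chart k p w) =
      \<i> * of_real k * (2 * cnj (1 - cnj z * w)) / ((p - z) * cnj (p - w))" by simp
  hence 2: "cmod (horo_chart k p z - cnj (horo_chart k p w)) =
      2 * k * cmod (1 - cnj z * w) / (cmod (p - z) * cmod (p - w))"
    using k by (simp only: norm_mult norm_divide complex_mod_cnj) simp
  show ?thesis
    unfolding 1 2 norm_divide using k pz by simp
qed

text \<open>Vertical lines are geodesics of the half-plane, so passing from one height to a larger
  one costs at least the logarithm of their ratio (halved in this normalization), with equality for
  vertically aligned points.\<close>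

lemma exp_hyperbolic_dist_horo_chart:
  assumes p: "cmod p = 1" and k: "k > 0" and z: "z \<in> unit_disk" and w: "w \<in> unit_disk"
    and le: "Im (horo_chart k p z) \<le> Im (horo_chart k p w)"
  shows "exp (2 * hyperbolic_dist z w) \<ge> Im (horo_chart k p w) / Im (horo_chart k p z)"
    and "Re (horo_chart k p z) = Re (horo_chart k p w) \<Longrightarrow>
      exp (2 * hyperbolic_dist z w) = Im (horo_chart k p w) / Im (horo_chart k p z)"
proof -
  define a b where "a = horo_chart k p z" "b = horo_chart k p w"
  define N D where "N = cmod (a - b)" "D = cmod (a - cnj b)"
  define x y s where "x = Re a - Re b" "y = Im a" "s = Im b"
  note defs = a_b_def N_D_def x_y_s_def
  have y: "0 < y" "y \<le> s" using horo_chart_bij(1)[OF p k z] le by (simp_all add: defs)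
  have N2: "N\<^sup>2 = x\<^sup>2 + (y - s)\<^sup>2" and D2: "D\<^sup>2 = x\<^sup>2 + (y + s)\<^sup>2"
    by (simp_all only: N_D_def cmod_power2 x_y_s_def) simp_all
  have N0: "0 \<le> N" "0 \<le> D" by (simp_all add: N_D_def)
  have "D\<^sup>2 > N\<^sup>2" using y mult_pos_pos[of y s] unfolding N2 D2 by (simp add: power2_eq_square algebra_simps)
  hence DN: "N < D" using N0 power_less_imp_less_base by blast
  have e0: "exp (2 * hyperbolic_dist z w) = (1 + N / D) / (1 - N / D)"
    using exp_hyperbolic_dist[OF z w] pseudo_hyperbolic_horo_chart[OF p k z w] by (simp add: defs)
  have e: "exp (2 * hyperbolic_dist z w) = (D + N) / (D - N)"
  proof -
    have "D > 0" using DN N0 by simp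
    hence "1 + N / D = (D + N) / D" "1 - N / D = (D - N) / D" by (simp_all add: field_simps)
    thus ?thesis using e0 \<open>D > 0\<close> by simp
  qed
  have "(D * (s - y))\<^sup>2 \<le> (N * (s + y))\<^sup>2"
  proof -
    \<comment> \<open>Only the horizontal offset \<open>x\<close> survives in this difference; it is
      the excess over a vertical path.\<close>
    have "(N * (s + y))\<^sup>2 - (D * (s - y))\<^sup>2 = 4 * x\<^sup>2 * (s * y)"
      unfolding power_mult_distrib N2 D2 by algebra
    moreover have "4 * x\<^sup>2 * (s * y) \<ge> 0" using y by simp
    ultimately show ?thesis by linarith
  qed
  moreover have "0 \<le> N * (s + y)" using y N0 by simp
  ultimately have "D * (s - y) \<le> N * (s + y)" by (rule power2_le_imp_le)
  hence "s * (D - N) \<le> y * (D + N)" by (simp add: algebra_simps)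
  thus "exp (2 * hyperbolic_dist z w) \<ge> Im (horo_chart k p w) / Im (horo_chart k p z)"
    unfolding e using DN y by (simp add: divide_simps mult_ac flip: a_b_def x_y_s_def)
  assume "Re (horo_chart k p z) = Re (horo_chart k p w)"
  hence "x = 0" by (simp add: defs)
  hence "N\<^sup>2 = (s - y)\<^sup>2" "D\<^sup>2 = (s + y)\<^sup>2" using N2 D2 by (simp_all add: power2_commute add.commute)
  hence "N = s - y" "D = s + y" using y N0 power2_eq_imp_eq[of N "s - y"] power2_eq_imp_eq[of D "s + y"] by auto
  hence "exp (2 * hyperbolic_dist z w) = s / y" unfolding e using y by simp
  thus "exp (2 * hyperbolic_dist z w) = Im (horo_chart k p w) / Im (horo_chart k p z)"
    by (simp add: defs)
qed

text \<open>The open disk is not compact, so the pseudo-hyperbolic distance, which is continuous up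
  to the unit circle, is minimized over the closed disk. It equals 1 on the circle and is smaller
  inside, hence the minimizer is an interior point.\<close>

lemma hyperbolic_dist_attains_inf:
  assumes "closed A" "A \<inter> unit_disk \<noteq> {}" and z: "z \<in> unit_disk"
  obtains \<omega> where "\<omega> \<in> A \<inter> unit_disk" "\<And>w. w \<in> A \<inter> unit_disk \<Longrightarrow> hyperbolic_dist z \<omega> \<le> hyperbolic_dist z w"
proof -
  define \<rho> where "\<rho> = (\<lambda>w. cmod ((z - w) / (1 - cnj z * w)))"
  have nz: "1 - cnj z * w \<noteq> 0" if "w \<in> cball 0 1" for w
    using cmod_lt_1_imp_one_minus_ne_0 z that by simp
  have "compact (A \<inter> cball 0 1)" using assms(1) by (simp add: closed_Int_compact)
  moreover have "continuous_on (A \<inter> cball 0 1) \<rho>"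
    unfolding \<rho>_def using nz by (intro continuous_intros) auto
  moreover have "A \<inter> cball 0 1 \<noteq> {}" using assms(2) by (auto simp: disjoint_iff less_imp_le)
  ultimately obtain \<omega> where \<omega>: "\<omega> \<in> A \<inter> cball 0 1" "\<And>w. w \<in> A \<inter> cball 0 1 \<Longrightarrow> \<rho> \<omega> \<le> \<rho> w"
    using continuous_attains_inf by metis
  obtain w0 where "w0 \<in> A \<inter> unit_disk" using assms(2) by blast
  hence \<rho>\<omega>: "\<rho> \<omega> < 1"
    using \<omega>(2)[of w0] pseudo_hyperbolic_lt_1[OF z, of w0] by (auto simp: \<rho>_def)
  have "cmod \<omega> \<noteq> 1"
  proof
    assume 1: "cmod \<omega> = 1"
    have "z - \<omega> = - \<omega> * cnj (1 - cnj z * \<omega>)"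
      using complex_norm_square[of \<omega>] 1 by (simp add: algebra_simps)
    hence "cmod (z - \<omega>) = cmod (1 - cnj z * \<omega>)"
      using 1 by (metis complex_mod_cnj mult_1 norm_minus_cancel norm_mult)
    hence "\<rho> \<omega> = 1" using nz \<omega>(1) by (simp add: \<rho>_def norm_divide)
    thus False using \<rho>\<omega> by simp
  qed
  hence \<omega>D: "\<omega> \<in> A \<inter> unit_disk" using \<omega>(1) by auto
  show ?thesis
  proof
    fix w assume w: "w \<in> A \<inter> unit_disk"
    have le: "\<rho> \<omega> \<le> \<rho> w" using w by (intro \<omega>(2)) auto
    have 0: "0 \<le> \<rho> \<omega>" "\<rho> w < 1" using pseudo_hyperbolic_lt_1[OF z, of w] w by (auto simp: \<rho>_def)
    have "(1 + \<rho> \<omega>) / (1 - \<rho> \<omega>) \<le> (1 + \<rho> w) / (1 - \<rho> w)"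
      using le 0 by (intro frac_le) auto
    hence "exp (2 * hyperbolic_dist z \<omega>) \<le> exp (2 * hyperbolic_dist z w)"
      using exp_hyperbolic_dist[OF z] \<omega>D w by (simp add: \<rho>_def)
    thus "hyperbolic_dist z \<omega> \<le> hyperbolic_dist z w" by simp
  qed (use \<omega>D in auto)
qed

section \<open>Horodisks and simple connectivity\<close>

text \<open>Tangency at \<open>p\<close> forces the center to be \<open>(1 - r) * p\<close>, so the
  circle is a horocycle at \<open>p\<close> and thus a level set of the height. This translates the
  Euclidean definition into chart terms.\<close>

lemma horodiskE:
  assumes "horodisk H"
  obtains k p where "cmod p = 1" "k > 0" "unit_disk - closure H = horo_crescent_at k p"
    "\<And>z. z \<in> unit_disk \<Longrightarrow> z \<in> frontier H \<Longrightarrow> Im (horo_chart k p z) = 1"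
    "p \<in> closure H" "connected (closure H)"
proof -
  obtain c r p where r: "0 < r" "H = ball c r" "H \<subseteq> unit_disk" and s: "sphere c r \<inter> sphere 0 1 = {p}"
    using assms by (auto simp: horodisk_def)
  have p: "cmod p = 1" and pc: "cmod (p - c) = r"
    using s by (auto simp: set_eq_iff dist_norm norm_minus_commute)
  have "cmod c + r \<le> 1" using r by (auto simp: ball_subset_ball_iff)
  moreover have "cmod (c + (p - c)) \<le> cmod c + cmod (p - c)" by (rule norm_triangle_ineq)
  \<comment> \<open>The chain 1 = |p| \<le> |c| + r \<le> 1 gives equality in the triangle
    inequality, so \<open>c\<close> and \<open>p - c\<close> have the same direction.\<close>
  ultimately have nc: "cmod c = 1 - r" and "cmod (c + (p - c)) = cmod c + cmod (p - c)" using p pc by auto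
  hence "(1 - r) *\<^sub>R (p - c) = r *\<^sub>R c" using pc by (metis norm_triangle_eq)
  hence c: "c = of_real (1 - r) * p" by (simp add: scaleR_conv_of_real algebra_simps)
  \<comment> \<open>A radius of 1 would make the two circles equal, and they would share both 1 and
    -1.\<close>
  have r1: "r < 1"
  proof (rule ccontr)
    assume "\<not> r < 1"
    hence "r = 1" "c = 0" using nc norm_ge_zero[of c] by auto
    hence "sphere (0::complex) 1 = {p}" using s by simp
    hence "p = 1" "p = -1" by (auto simp: set_eq_iff)
    thus False by simp
  qed
  \<comment> \<open>This scale puts the circle \<open>sphere c r\<close> at height 1 in the half-plane.\<close>
  define k where "k = r / (1 - r)"
  have k: "k > 0" using r r1 by (simp add: k_def)
  \<comment> \<open>The sign of the left side tells on which side of the circle \<open>z\<close>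
    lies; the sign of the right side compares its height with 1.\<close>
  have id: "(dist c z)\<^sup>2 - r\<^sup>2 = (1 - r) * (cmod (p - z))\<^sup>2 - r * (1 - (cmod z)\<^sup>2)" for z
  proof -
    have "(Re p)\<^sup>2 + (Im p)\<^sup>2 = 1" using p cmod_power2[of p] by simp
    thus ?thesis
      unfolding dist_norm c by (simp add: cmod_power2) algebra
  qed
  have iff: "(Im (horo_chart k p z) < 1 \<longleftrightarrow> r < dist c z)"
    "(Im (horo_chart k p z) = 1 \<longleftrightarrow> r = dist c z)" if z: "z \<in> unit_disk" for z
  proof -
    have pz: "(cmod (p - z))\<^sup>2 > 0" using z p by auto
    have "Im (horo_chart k p z) < 1 \<longleftrightarrow> r * (1 - (cmod z)\<^sup>2) < (1 - r) * (cmod (p - z))\<^sup>2"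
      unfolding Im_horo_chart[OF p] k_def using pz r1 by (simp add: divide_less_eq mult_ac)
    also have "\<dots> \<longleftrightarrow> r\<^sup>2 < (dist c z)\<^sup>2" using id[of z] by linarith
    also have "\<dots> \<longleftrightarrow> r < dist c z" using r power_mono_iff[of "dist c z" r 2] by (simp flip: not_le)
    finally show "(Im (horo_chart k p z) < 1 \<longleftrightarrow> r < dist c z)" .
    have "Im (horo_chart k p z) = 1 \<longleftrightarrow> r * (1 - (cmod z)\<^sup>2) = (1 - r) * (cmod (p - z))\<^sup>2"
      unfolding Im_horo_chart[OF p] k_def using pz r1 by (simp add: divide_eq_eq mult_ac)
    also have "\<dots> \<longleftrightarrow> r\<^sup>2 = (dist c z)\<^sup>2" using id[of z] by linarith
    also have "\<dots> \<longleftrightarrow> r = dist c z" using r by simp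
    finally show "(Im (horo_chart k p z) = 1 \<longleftrightarrow> r = dist c z)" .
  qed
  have cl: "closure H = cball c r" using r by simp
  show ?thesis
  proof
    show "unit_disk - closure H = horo_crescent_at k p"
      unfolding cl horo_crescent_at_def using iff by auto
    show "Im (horo_chart k p z) = 1" if "z \<in> unit_disk" "z \<in> frontier H" for z
      using iff(2)[OF that(1)] that(2) r by simp
    show "p \<in> closure H" unfolding cl using pc by (simp add: dist_norm norm_minus_commute)
    show "connected (closure H)" unfolding cl by (simp add: convex_connected)
  qed (use p k in auto)
qed

text \<open>A bounded component \<open>C\<close> of the complement stays inside the disk, because
  the exterior of the disk is connected, unbounded and disjoint from \<open>G\<close>. A frontier
  point of \<open>C\<close> is a frontier point of \<open>G\<close>, and the closed horodisk
  attached there is connected and misses \<open>G\<close>. It therefore lies in \<open>C\<close>,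
  although its tangency point is on the unit circle.\<close>

lemma horo_convex_imp_simply_connected:
  assumes "horo_convex_domain G"
  shows "simply_connected G"
proof -
  have G: "open G" "connected G" "G \<noteq> {}" "G \<subseteq> unit_disk"
    and hc: "\<And>\<omega>. \<omega> \<in> unit_disk \<Longrightarrow> \<omega> \<in> frontier G \<Longrightarrow> \<exists>H. horodisk H \<and> \<omega> \<in> frontier H \<and> G \<inter> H = {}"
    using assms by (auto simp: horo_convex_domain_def is_domain_def)
  have "\<not> bounded C" if C: "C \<in> components (- G)" for C
  proof
    assume b: "bounded C"
    have conC: "connected C" and C0: "C \<noteq> {}" using C in_components_connected in_components_nonempty by auto
    have inC: "S \<subseteq> C" if "connected S" "S \<subseteq> - G" "S \<inter> C \<noteq> {}" for S
      using components_maximal[OF C that(1,2)] that(3) by blast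
    have unb: "\<not> bounded (- unit_disk :: complex set)"
      by (simp add: cobounded_imp_unbounded)
    have "connected (- unit_disk :: complex set)"
      by (rule connected_complement_bounded_convex) auto
    hence CD: "C \<subseteq> unit_disk" using inC[of "- unit_disk"] G(4) b bounded_subset unb by blast
    have clC: "closed C" using C G(1) closed_components by blast
    have "frontier C \<noteq> {}" using b C0 frontier_eq_empty not_bounded_UNIV by metis
    then obtain \<omega> where \<omega>: "\<omega> \<in> frontier C" by blast
    have \<omega>C: "\<omega> \<in> C" using \<omega> clC frontier_subset_closed by blast
    have "\<omega> \<in> frontier G" using \<omega> frontier_of_components_subset[OF C] by (auto simp: frontier_complement)
    then obtain H where H: "horodisk H" "\<omega> \<in> frontier H" "G \<inter> H = {}" using hc \<omega>C CD by blast
    obtain k p where p: "cmod p = 1" "p \<in> closure H" "connected (closure H)" using horodiskE[OF H(1)] by metis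
    have "closure H \<subseteq> - G" using H(3) open_Int_closure_eq_empty[OF G(1), of H] by blast
    moreover have "\<omega> \<in> closure H" using H(2) by (simp add: frontier_def)
    ultimately have "closure H \<subseteq> C" using inC p(3) \<omega>C by blast
    thus False using CD p by auto
  qed
  thus ?thesis using simply_connected_eq_unbounded_complement_components[OF G(1)] G(2) by blast
qed

section \<open>Distance to the boundary\<close>

text \<open>Connectedness of the disk provides a frontier point inside it, so the infimum runs over
  a nonempty set and is a minimum.\<close>

lemma hyperbolic_boundary_dist_attained:
  assumes "G \<subset> unit_disk" "z \<in> G"
  obtains \<omega> where "\<omega> \<in> frontier G" "\<omega> \<in> unit_disk" "hyperbolic_boundary_dist G z = hyperbolic_dist z \<omega>"
    "\<And>w. w \<in> frontier G \<Longrightarrow> w \<in> unit_disk \<Longrightarrow> hyperbolic_dist z \<omega> \<le> hyperbolic_dist z w"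
proof -
  have "unit_disk \<inter> frontier G \<noteq> {}"
    by (rule connected_Int_frontier) (use assms in auto)
  moreover have "z \<in> unit_disk" using assms by blast
  ultimately obtain \<omega> where \<omega>: "\<omega> \<in> frontier G \<inter> unit_disk"
    "\<And>w. w \<in> frontier G \<inter> unit_disk \<Longrightarrow> hyperbolic_dist z \<omega> \<le> hyperbolic_dist z w"
    using hyperbolic_dist_attains_inf[OF frontier_closed, of G z] by (metis Int_commute)
  have "hyperbolic_boundary_dist G z = hyperbolic_dist z \<omega>"
    unfolding hyperbolic_boundary_dist_def by (rule cInf_eq_minimum) (use \<omega> in auto)
  thus ?thesis using that \<omega> by blast
qed

text \<open>Frontier points in the disk have height at least 1, which bounds the distance from
  below. The vertical segment from the image of \<open>z\<close> up to height 1 gives the matching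
  upper bound.\<close>

lemma hyperbolic_boundary_dist_horo_crescent_at:
  assumes p: "cmod p = 1" and k: "k > 0" and z: "z \<in> horo_crescent_at k p"
  shows "exp (2 * hyperbolic_boundary_dist (horo_crescent_at k p) z) = 1 / Im (horo_chart k p z)"
proof -
  let ?G = "horo_crescent_at k p" and ?\<phi> = "horo_chart k p"
  define y where "y = Im (?\<phi> z)"
  define b where "b = Complex (Re (?\<phi> z)) 1"
  have zD: "z \<in> unit_disk" and y: "0 < y" "y < 1"
    using z horo_chart_bij(1)[OF p k, of z] by (auto simp: horo_crescent_at_def y_def)
  have b: "Im b > 0" by (simp add: b_def)
  have inv: "horo_chart_inv k p b \<in> unit_disk" "?\<phi> (horo_chart_inv k p b) = b"
    using horo_chart_inv_norm(3)[OF p k b] horo_chart_bij(3)[OF p k b] by auto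
  have notG: "Im (?\<phi> w) \<ge> 1" if "w \<in> frontier ?G" "w \<in> unit_disk" for w
    using that open_horo_crescent_at[OF p, of k] by (auto simp: frontier_def interior_open horo_crescent_at_def)
  have "horo_chart_inv k p b \<notin> ?G" using inv by (simp add: horo_crescent_at_def b_def)
  hence "?G \<noteq> unit_disk" using inv by blast
  hence ps: "?G \<subset> unit_disk" by (auto simp: horo_crescent_at_def)
  obtain \<omega> where \<omega>: "\<omega> \<in> frontier ?G" "\<omega> \<in> unit_disk" "hyperbolic_boundary_dist ?G z = hyperbolic_dist z \<omega>"
    "\<And>w. w \<in> frontier ?G \<Longrightarrow> w \<in> unit_disk \<Longrightarrow> hyperbolic_dist z \<omega> \<le> hyperbolic_dist z w"
    using hyperbolic_boundary_dist_attained[OF ps z] by metis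
  have seg: "Re v = Re (?\<phi> z)" "y \<le> Im v" "Im v \<le> 1" if v: "v \<in> closed_segment (?\<phi> z) b" for v
  proof -
    obtain t where t: "0 \<le> t" "t \<le> 1" "v = (1 - t) *\<^sub>R ?\<phi> z + t *\<^sub>R b"
      using v by (auto simp: closed_segment_def)
    have "Im v = y + t * (1 - y)" "Re v = Re (?\<phi> z)" 
      unfolding t(3) by (simp_all add: b_def y_def) (simp_all add: algebra_simps)
    moreover have "0 \<le> t * (1 - y)" "t * (1 - y) \<le> 1 * (1 - y)" using t y by (auto intro: mult_right_mono)
    ultimately show "Re v = Re (?\<phi> z)" "y \<le> Im v" "Im v \<le> 1" by auto
  qed
  let ?S = "horo_chart_inv k p ` closed_segment (?\<phi> z) b"
  have "isCont (horo_chart_inv k p) v" if "v \<in> closed_segment (?\<phi> z) b" for v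
  proof -
    have "Im v > 0" using seg[OF that] y by simp
    thus ?thesis using horo_chart_inv_norm(1)[OF p k] DERIV_isCont[OF horo_chart_inv_deriv] by blast
  qed
  hence "connected ?S"
    by (intro connected_continuous_image continuous_at_imp_continuous_on) auto
  moreover have "?S \<inter> ?G \<noteq> {}"
    using horo_chart_bij(2)[OF p k zD] z by (metis IntI empty_iff ends_in_segment(1) imageI)
  moreover have "?S - ?G \<noteq> {}" using \<open>horo_chart_inv k p b \<notin> ?G\<close> by blast
  \<comment> \<open>The pulled-back segment starts in the crescent and ends outside it, so it meets
    the frontier. The meeting point has height at least 1 as a frontier point and at most 1 as a
    point of the segment.\<close>
  ultimately have "?S \<inter> frontier ?G \<noteq> {}" by (rule connected_Int_frontier)
  then obtain v where v: "v \<in> closed_segment (?\<phi> z) b" "horo_chart_inv k p v \<in> frontier ?G" by blast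
  define w where "w = horo_chart_inv k p v"
  have "Im v > 0" using seg[OF v(1)] y by simp
  hence w: "w \<in> unit_disk" "?\<phi> w = v"
    using horo_chart_inv_norm(3)[OF p k, of v] horo_chart_bij(3)[OF p k, of v] by (auto simp: w_def)
  have wf: "w \<in> frontier ?G" using v(2) by (simp add: w_def)
  have "Im (?\<phi> w) = 1" using notG[OF wf w(1)] seg(3)[OF v(1)] w(2) by simp
  hence 1: "exp (2 * hyperbolic_dist z w) = 1 / y"
    using exp_hyperbolic_dist_horo_chart(2)[OF p k zD w(1)] seg(1)[OF v(1)] w(2) y by (simp add: y_def)
  have "1 / y \<le> Im (?\<phi> \<omega>) / y" using notG[OF \<omega>(1,2)] y by (simp add: divide_right_mono)
  also have "\<dots> \<le> exp (2 * hyperbolic_dist z \<omega>)"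
    unfolding y_def using notG[OF \<omega>(1,2)] y
    by (intro exp_hyperbolic_dist_horo_chart(1)[OF p k zD \<omega>(2)]) (simp add: y_def)
  finally have "1 / y \<le> exp (2 * hyperbolic_dist z \<omega>)" .
  moreover have "exp (2 * hyperbolic_dist z \<omega>) \<le> 1 / y" using \<omega>(4)[OF wf w(1)] 1[symmetric] by simp
  ultimately show ?thesis by (simp add: \<omega>(3) y_def)
qed

section \<open>The density bound and its equality case\<close>

theorem theorem2:
  fixes G :: "complex set"
  assumes "horo_convex_domain G" and "G \<noteq> unit_disk"
  shows "\<forall>z\<in>G.
     hyperbolic_density G z \<ge>
       pi / exp (2 * hyperbolic_boundary_dist G z) *
       (1 / sin (pi / exp (2 * hyperbolic_boundary_dist G z))) \<and>
     (hyperbolic_density G z =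
       pi / exp (2 * hyperbolic_boundary_dist G z) *
       (1 / sin (pi / exp (2 * hyperbolic_boundary_dist G z)))
      \<longleftrightarrow> horo_crescent G)"
proof
  fix z assume z: "z \<in> G"
  define x where "x = pi / exp (2 * hyperbolic_boundary_dist G z)"
  have G: "open G" "connected G" "G \<noteq> {}" "G \<subset> unit_disk" and dom: "is_domain G"
    and hc: "\<And>\<omega>. \<omega> \<in> unit_disk \<Longrightarrow> \<omega> \<in> frontier G \<Longrightarrow> \<exists>H. horodisk H \<and> \<omega> \<in> frontier H \<and> G \<inter> H = {}"
    using assms by (auto simp: horo_convex_domain_def is_domain_def)
  have zD: "z \<in> unit_disk" using z G by blast
  hence zpos: "1 - (cmod z)\<^sup>2 > 0" by (simp add: abs_square_less_1)
  have "G \<noteq> UNIV" using G(4) by auto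
  then obtain f g where fg: "f holomorphic_on G" "\<forall>z\<in>G. f z \<in> unit_disk \<and> g (f z) = z"
       "\<forall>z\<in>unit_disk. g z \<in> G \<and> f (g z) = z"
    using Riemann_mapping_theorem[of G] G horo_convex_imp_simply_connected[OF assms(1)] by auto
  have bij: "bij_betw f G unit_disk"
    by (rule bij_betw_byWitness[of _ g]) (use fg in auto)
  obtain \<omega> where \<omega>: "\<omega> \<in> frontier G" "\<omega> \<in> unit_disk" "hyperbolic_boundary_dist G z = hyperbolic_dist z \<omega>"
    using hyperbolic_boundary_dist_attained[OF G(4) z] by metis
  obtain H where H: "horodisk H" "\<omega> \<in> frontier H" "G \<inter> H = {}" using hc[OF \<omega>(2,1)] by blast
  obtain k p where p: "cmod p = 1" and k: "k > 0" and cres: "unit_disk - closure H = horo_crescent_at k p"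
    and fH: "\<And>z. z \<in> unit_disk \<Longrightarrow> z \<in> frontier H \<Longrightarrow> Im (horo_chart k p z) = 1"
    using horodiskE[OF H(1)] by metis
  define G0 where "G0 = horo_crescent_at k p"
  have "closure H \<inter> G = {}" using H(3) open_Int_closure_eq_empty[OF G(1), of H] by blast
  hence sub: "G \<subseteq> G0" using G(4) cres by (auto simp: G0_def)
  hence zG0: "z \<in> horo_crescent_at k p" using z by (auto simp: G0_def)
  define y where "y = Im (horo_chart k p z)"
  have y: "0 < y" "y < 1"
    using zG0 horo_chart_bij(1)[OF p k zD] by (auto simp: horo_crescent_at_def y_def)
  \<comment> \<open>The nearest boundary point \<open>\<omega>\<close> lies on the frontier of
    \<open>H\<close>, hence at height 1, while \<open>z\<close> is at height \<open>y\<close>. In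
    terms of \<open>x\<close> this says \<open>x \<le> pi * y\<close>.\<close>
  have "1 / y \<le> exp (2 * hyperbolic_boundary_dist G z)"
    using exp_hyperbolic_dist_horo_chart(1)[OF p k zD \<omega>(2)] fH[OF \<omega>(2) H(2)] y \<omega>(3) by (simp add: y_def)
  hence x: "0 < x" "x \<le> pi * y" using y by (simp_all add: x_def field_simps)
  have 1: "x / sin x \<le> pi * y / sin (pi * y)"
    by (rule divide_sin_mono) (use x y in auto)
  obtain \<Psi> where \<Psi>: "\<Psi> holomorphic_on G0" "bij_betw \<Psi> G0 unit_disk"
    unfolding G0_def using horo_crescent_at_uniformization[OF p k] by metis
  have "open G0" using open_horo_crescent_at[OF p] by (simp add: G0_def)
  note mono = hyperbolic_metric_mono[OF G(1) fg(1) bij z \<open>open G0\<close> \<Psi> sub]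
  have d0: "hyperbolic_density G0 z = pi * y / sin (pi * y)"
    unfolding G0_def y_def by (rule horo_crescent_at_density[OF p k zG0])
  have 2: "hyperbolic_density G0 z \<le> hyperbolic_density G z"
    unfolding hyperbolic_density_def using mono(1) zpos by (intro mult_left_mono) auto
  \<comment> \<open>As \<open>z\<close> is arbitrary, this covers both readings: equality at a
    single point forces a crescent, and in a crescent equality holds at every point.\<close>
  have "hyperbolic_density G z = x / sin x \<longleftrightarrow> horo_crescent G"
  proof
    assume "hyperbolic_density G z = x / sin x"
    \<comment> \<open>Equality of the two ends collapses the chain from \<open>x / sin x\<close>
      through the density of \<open>G0\<close> to that of \<open>G\<close>.\<close>
    hence "hyperbolic_density G0 z = hyperbolic_density G z" using 1 2 d0 by linarith
    hence "hyperbolic_metric G0 z = hyperbolic_metric G z"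
      using zpos by (simp add: hyperbolic_density_def)
    hence "G = unit_disk - closure H" using mono(2) cres by (simp add: G0_def)
    thus "horo_crescent G" unfolding horo_crescent_def using dom H(1) by blast
  next
    assume "horo_crescent G"
    then obtain H' where "horodisk H'" "G = unit_disk - closure H'" by (auto simp: horo_crescent_def)
    \<comment> \<open>The chart of \<open>H'\<close> replaces the one of \<open>H\<close>: in it
      both the density and the boundary distance of \<open>G\<close> are known exactly.\<close>
    then obtain k' p' where p': "cmod p' = 1" "k' > 0" "G = horo_crescent_at k' p'"
      using horodiskE by metis
    have "x = pi * Im (horo_chart k' p' z)"
      unfolding x_def using hyperbolic_boundary_dist_horo_crescent_at[OF p'(1,2)] z p'(3) by simp
    thus "hyperbolic_density G z = x / sin x"
      using horo_crescent_at_density[OF p'(1,2)] z p'(3) by simp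
  qed
  thus "hyperbolic_density G z \<ge>
       pi / exp (2 * hyperbolic_boundary_dist G z) *
       (1 / sin (pi / exp (2 * hyperbolic_boundary_dist G z))) \<and>
     (hyperbolic_density G z =
       pi / exp (2 * hyperbolic_boundary_dist G z) *
       (1 / sin (pi / exp (2 * hyperbolic_boundary_dist G z)))
      \<longleftrightarrow> horo_crescent G)"
    using 1 2 d0 by (simp flip: x_def)
qed

end
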